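(* Let $G$ be a finite abstract simplicial complex with vertex set $V$, let $g:V\to\{-1,1\}$ be a random function distributed according to the Bayes measure $P$, and let $H=G_g$ be the resulting random codimension-1 complex in $G$. Then $$\mathrm{E}[\chi(H)] = 2-2K(G)-\chi(G).$$
   Context: A finite abstract simplicial complex $G$ is a finite set of non-empty finite sets closed under taking non-empty subsets. For $x\in G$, $\dim(x)=|x|-1$. Its vertex set is $V=\bigcup_{x\in G}x$. Write $f_k(G)$ for the number of $x\in G$ with $\dim(x)=k$ and $q$ for the maximal dimension of $G$. Euler characteristic: $\chi(G)=\sum_{x\in G}(-1)^{\dim(x)}=\sum_{k=0}^q(-1)^kf_k(G)$. Curvature functional: $K(G)=1-\frac{f_0(G)}{2}+\frac{f_1(G)}{3}-\cdots=1+\sum_{k=0}^q(-1)^{k+1}\frac{f_k(G)}{k+2}$. Level surface: for $g:V\to\{-1,1\}$, $G_g=\{x\in G : g(x)=\{-1,1\}\}$, i.e. the set of simplices of $G$ on which $g$ takes both values. It is regarded as a delta set in which a $k$-simplex $x$ of $G$ has dimension $k-1$ (so the edges of $G$ lying in $G_g$ are its points). Accordingly $\chi(G_g)=\sum_{x\in G_g}(-1)^{\dim(x)-1}$, with $\chi(\emptyset)=0$. Bayes measure: with $n=|V|$, $P$ is the probability measure on $\{-1,1\}^V$ obtained by choosing $p$ uniformly in $[0,1]$ and then, given $p$, letting the values $g(v)$, $v\in V$, be independent with value $1$ with probability $p$ and $-1$ with probability $1-p$. Equivalently, $P(\{g\})=\frac{1}{(n+1)\binom{n}{m}}$ if $g$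 takes the value $1$ exactly $m$ times. $\mathrm{E}$ denotes expectation with respect to $P$. *)

theory Defs
  imports "HOL-Probability.Probability"
begin

definition abstract_simplicial_complex :: "'a set set \<Rightarrow> bool" where
  "abstract_simplicial_complex G \<longleftrightarrow>
     finite G \<and> (\<forall>x\<in>G. finite x \<and> x \<noteq> {}) \<and> (\<forall>x\<in>G. \<forall>y\<subseteq>x. y \<noteq> {} \<longrightarrow> y \<in> G)"

definition vertices :: "'a set set \<Rightarrow> 'a set" where
  "vertices G = \<Union>G"

text \<open>Simplices are non-empty, so the truncated subtraction is harmless.\<close>

definition sdim :: "'a set \<Rightarrow> nat" where
  "sdim x = card x - 1"

definition f_number :: "'a set set \<Rightarrow> nat \<Rightarrow> nat" where
  "f_number G k = card {x \<in> G. sdim x = k}"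

text \<open>For the empty complex \<open>Max {}\<close> is an unspecified number; this does not affect
  \<open>curvature_functional\<close> below, because all the f-numbers of the empty complex vanish.\<close>

definition max_dim :: "'a set set \<Rightarrow> nat" where
  "max_dim G = Max (sdim ` G)"

text \<open>The dimension function \<open>d\<close> is a parameter because the same set of simplices carries
  a different dimension when it is viewed inside a level surface.\<close>

definition euler_char_with :: "('a set \<Rightarrow> nat) \<Rightarrow> 'a set set \<Rightarrow> int" where
  "euler_char_with d X = (\<Sum>x\<in>X. (- 1) ^ d x)"

definition euler_char :: "'a set set \<Rightarrow> int" where
  "euler_char G = euler_char_with sdim G"

definition curvature_functional :: "'a set set \<Rightarrow> real" where
  "curvature_functional G =
     1 + (\<Sum>k = 0..max_dim G. (- 1) ^ (k + 1) * real (f_number G k) / real (k + 2))"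

definition level_surface :: "'a set set \<Rightarrow> ('a \<Rightarrow> int) \<Rightarrow> 'a set set" where
  "level_surface G g = {x \<in> G. g ` x = {- 1, 1}}"

text \<open>A simplex in a level surface has at least two vertices, so \<open>sdim x - 1\<close> does not
  truncate.\<close>

definition level_surface_euler_char :: "'a set set \<Rightarrow> ('a \<Rightarrow> int) \<Rightarrow> int" where
  "level_surface_euler_char G g = euler_char_with (\<lambda>x. sdim x - 1) (level_surface G g)"

text \<open>The law of independent signs, each \<open>1\<close> with probability \<open>p\<close> and \<open>- 1\<close> with
  probability \<open>1 - p\<close>. Its space is the set of (extensional) functions from \<open>V\<close> to
  \<open>{- 1, 1}\<close>, with all subsets measurable if \<open>V\<close> is finite. It is a probability measure
  only for \<open>p\<close> in the unit interval.\<close>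

definition iid_signs :: "'a set \<Rightarrow> real \<Rightarrow> ('a \<Rightarrow> int) measure" where
  "iid_signs V p =
     (\<Pi>\<^sub>M v\<in>V. point_measure {- 1, 1} (\<lambda>s. ennreal (if s = 1 then p else 1 - p)))"

text \<open>The mixture of these laws for \<open>p\<close> uniform in the unit interval. Restricting
  the space, rather than using \<open>uniform_measure lborel {0..1}\<close>, keeps the kernel
  away from parameters where it is not a probability measure.\<close>

definition bayes_measure :: "'a set \<Rightarrow> ('a \<Rightarrow> int) measure" where
  "bayes_measure V = restrict_space lborel {0..1} \<bind> iid_signs V"


lemma prob_space_sign:
  assumes "p \<in> {0..1}"
  shows "prob_space (point_measure {- 1, 1::int} (\<lambda>s. ennreal (if s = 1 then p else 1 - p)))"
proof
  have "emeasure (point_measure {- 1, 1::int} (\<lambda>s. ennreal (if s = 1 then p else 1 - p))) {-1,1}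
     = ennreal (1 - p) + ennreal p"
    by (subst emeasure_point_measure_finite) auto
  also have "\<dots> = 1" using assms by (simp flip: ennreal_plus)
  finally show "emeasure (point_measure {- 1, 1::int} (\<lambda>s. ennreal (if s = 1 then p else 1 - p)))
    (space (point_measure {- 1, 1::int} (\<lambda>s. ennreal (if s = 1 then p else 1 - p)))) = 1"
    by (simp add: space_point_measure)
qed

lemma prob_space_iid_signs: "p \<in> {0..1} \<Longrightarrow> prob_space (iid_signs V p)"
  unfolding iid_signs_def by (intro prob_space_PiM prob_space_sign)

lemma sets_iid_signs:
  assumes "finite V"
  shows "sets (iid_signs V p) = Pow (V \<rightarrow>\<^sub>E {- 1, 1})"
proof -
  have "sets (iid_signs V p) = sets (\<Pi>\<^sub>M v\<in>V. count_space {- 1, 1::int})"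
    unfolding iid_signs_def by (intro sets_PiM_cong) (auto simp: sets_point_measure)
  also have "\<dots> = sets (count_space (V \<rightarrow>\<^sub>E {- 1, 1::int}))"
    using assms by (subst count_space_PiM_finite) auto
  finally show ?thesis by simp
qed

lemma emeasure_iid_signs:
  assumes "finite V" "p \<in> {0..1}" "g \<in> V \<rightarrow>\<^sub>E {- 1, 1}"
  shows "emeasure (iid_signs V p) {g} = ennreal (\<Prod>v\<in>V. if g v = 1 then p else 1 - p)"
proof -
  let ?M = "point_measure {- 1, 1::int} (\<lambda>s. ennreal (if s = 1 then p else 1 - p))"
  interpret prob_space ?M by (rule prob_space_sign) fact
  interpret product_sigma_finite "\<lambda>_::'a. ?M" ..
  have "{g} = (\<Pi>\<^sub>E v\<in>V. {g v})" using assms(3) by (simp add: PiE_singleton PiE_iff)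
  then have "emeasure (iid_signs V p) {g} = (\<Prod>v\<in>V. emeasure ?M {g v})"
    unfolding iid_signs_def using assms
    by (subst emeasure_PiM[symmetric]) (auto simp: sets_point_measure PiE_iff)
  also have "\<dots> = (\<Prod>v\<in>V. ennreal (if g v = 1 then p else 1 - p))"
    using assms(3) by (intro prod.cong refl, subst emeasure_point_measure_finite) (auto simp: PiE_iff)
  also have "\<dots> = ennreal (\<Prod>v\<in>V. if g v = 1 then p else 1 - p)"
    using assms by (intro prod_ennreal) auto
  finally show ?thesis .
qed

lemma iid_signs_measurable:
  assumes "finite V"
  shows "iid_signs V \<in> restrict_space lborel {0..1} \<rightarrow>\<^sub>M
    subprob_algebra (count_space (V \<rightarrow>\<^sub>E {- 1, 1}))"
proof (rule measurable_subprob_algebra)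
  fix p :: real assume "p \<in> space (restrict_space lborel {0..1})"
  then show "subprob_space (iid_signs V p)"
    by (intro prob_space_imp_subprob_space prob_space_iid_signs) (auto simp: space_restrict_space)
next
  show "sets (iid_signs V p) = sets (count_space (V \<rightarrow>\<^sub>E {- 1, 1}))" for p
    using assms by (simp add: sets_iid_signs)
next
  fix A assume "A \<in> sets (count_space (V \<rightarrow>\<^sub>E {- 1, 1::int}))"
  then have A: "A \<subseteq> V \<rightarrow>\<^sub>E {- 1, 1}" by simp
  then have fin: "finite A" using assms by (auto intro: finite_subset finite_PiE)
  have eq: "emeasure (iid_signs V p) A
      = (\<Sum>g\<in>A. ennreal (\<Prod>v\<in>V. if g v = 1 then p else 1 - p))"
    if "p \<in> space (restrict_space lborel {0..1})" for p
  proof -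
    have "emeasure (iid_signs V p) A = (\<Sum>g\<in>A. emeasure (iid_signs V p) {g})"
      using A fin assms by (intro emeasure_eq_sum_singleton) (auto simp: sets_iid_signs)
    with that A assms show ?thesis
      by (auto intro!: sum.cong emeasure_iid_signs simp: space_restrict_space)
  qed
  have "(\<lambda>p. \<Sum>g\<in>A. ennreal (\<Prod>v\<in>V. if g v = 1 then p else 1 - p))
    \<in> borel_measurable (restrict_space lborel {0..1})"
    by (intro measurable_restrict_space1) measurable
  then show "(\<lambda>p. emeasure (iid_signs V p) A) \<in> borel_measurable (restrict_space lborel {0..1})"
    using eq by (subst measurable_cong) auto
qed

lemma prob_space_bayes_measure:
  assumes "finite V"
  shows "prob_space (bayes_measure V)"
proof -
  have "prob_space (restrict_space lborel {0..1::real})"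
    by (intro prob_spaceI) (simp add: space_restrict_space emeasure_restrict_space)
  then show ?thesis unfolding bayes_measure_def
    using assms by (intro prob_space.prob_space_bind[OF _ _ iid_signs_measurable] AE_I2
       prob_space_iid_signs) (auto simp: space_restrict_space)
qed
end

theory Submission
  imports Defs
begin

text \<open>
  By linearity of expectation, each simplex \<open>x\<close> of dimension \<open>k\<close> contributes
  \<open>(-1) ^ (k - 1)\<close> times the probability that \<open>g\<close> takes both values on \<open>x\<close>. Given \<open>p\<close>, all
  \<open>k + 1\<close> vertices of \<open>x\<close> carry the value \<open>1\<close> with probability \<open>p ^ (k + 1)\<close>; averaging over \<open>p\<close>
  gives \<open>1 / (k + 2)\<close>, and by symmetry the same holds for \<open>- 1\<close>
  (\<open>bayes_measure_constant_on\<close>). Hence \<open>g\<close> takes both values with probability \<open>1 - 2 / (k + 2)\<close>,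
  whatever the rest of the complex looks like (\<open>bayes_measure_both_signs\<close>).

  The term \<open>1\<close> sums to \<open>- \<chi>(G)\<close>, because the dimension drops by one, and the
  term \<open>- 2 / (k + 2)\<close> sums to \<open>2 - 2 K(G)\<close>, since the denominators \<open>k + 2\<close> are exactly those of the
  curvature functional. A vertex never belongs to a level surface; it may still be included in both
  sums, because the factor \<open>1 - 2 / (k + 2)\<close> vanishes for \<open>k = 0\<close>.
\<close>

lemma uniform_parameter_space_nonempty: "space (restrict_space lborel {0..1::real}) \<noteq> {}"
proof -
  have "(0::real) \<in> space (restrict_space lborel {0..1})"
    by (simp add: space_restrict_space)
  then show ?thesis by blast
qed

lemma sets_bayes_measure:
  assumes "finite V"
  shows "sets (bayes_measure V) = Pow (V \<rightarrow>\<^sub>E {- 1, 1})"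
proof -
  have "sets (bayes_measure V) = sets (count_space (V \<rightarrow>\<^sub>E {- 1, 1}))"
    unfolding bayes_measure_def using assms uniform_parameter_space_nonempty
    by (intro sets_bind) (simp_all add: sets_iid_signs)
  then show ?thesis by simp
qed

lemma space_bayes_measure:
  assumes "finite V"
  shows "space (bayes_measure V) = V \<rightarrow>\<^sub>E {- 1, 1}"
  using sets_eq_imp_space_eq[of "bayes_measure V" "count_space (V \<rightarrow>\<^sub>E {- 1, 1})"]
    sets_bayes_measure[OF assms] by simp

text \<open>The event is a box, so its probability is a product over \<open>V\<close> in which every vertex outside
  \<open>x\<close> contributes the factor \<open>1\<close>.\<close>

lemma emeasure_iid_signs_constant_on:
  assumes "finite V" "x \<subseteq> V" "p \<in> {0..1}" "s \<in> {- 1, 1}"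
  shows "emeasure (iid_signs V p) {g \<in> V \<rightarrow>\<^sub>E {- 1, 1}. \<forall>v\<in>x. g v = s}
    = ennreal ((if s = 1 then p else 1 - p) ^ card x)"
proof -
  let ?M = "point_measure {- 1, 1::int} (\<lambda>s. ennreal (if s = 1 then p else 1 - p))"
  let ?q = "if s = 1 then p else 1 - p"
  interpret prob_space ?M by (rule prob_space_sign) fact
  interpret product_sigma_finite "\<lambda>_::'a. ?M" ..
  define B where "B v = (if v \<in> x then {s} else {- 1, 1})" for v
  have box: "{g \<in> V \<rightarrow>\<^sub>E {- 1, 1}. \<forall>v\<in>x. g v = s} = (\<Pi>\<^sub>E v\<in>V. B v)"
    using assms(2,4) by (auto simp: B_def PiE_iff extensional_def split: if_splits)
  have factor: "emeasure ?M (B v) = (if v \<in> x then ennreal ?q else 1)" for v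
  proof (cases "v \<in> x")
    case True
    then show ?thesis using assms(4)
      by (auto simp: B_def emeasure_point_measure_finite)
  next
    case False
    then show ?thesis using emeasure_space_1 by (simp add: B_def space_point_measure)
  qed
  have "emeasure (iid_signs V p) (\<Pi>\<^sub>E v\<in>V. B v) = (\<Prod>v\<in>V. emeasure ?M (B v))"
    unfolding iid_signs_def using assms
    by (intro emeasure_PiM) (auto simp: sets_point_measure B_def)
  also have "\<dots> = (\<Prod>v\<in>x. ennreal ?q)"
    unfolding factor using assms(1,2)
    by (simp add: prod.If_cases Int_absorb1)
  also have "\<dots> = ennreal (?q ^ card x)"
    using assms(3) by (auto simp: ennreal_power)
  finally show ?thesis unfolding box .
qed

text \<open>Mixing over \<open>p\<close> turns the power \<open>p ^ n\<close> (or \<open>(1 - p) ^ n\<close>) into the moment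
  \<open>1 / (n + 1)\<close> of the uniform distribution.\<close>

lemma bayes_measure_constant_on:
  assumes "finite V" "x \<subseteq> V" "s \<in> {- 1, 1}"
  shows "measure (bayes_measure V) {g \<in> V \<rightarrow>\<^sub>E {- 1, 1}. \<forall>v\<in>x. g v = s} = 1 / real (card x + 1)"
proof -
  let ?A = "{g \<in> V \<rightarrow>\<^sub>E {- 1, 1}. \<forall>v\<in>x. g v = s}"
  let ?U = "restrict_space lborel {0..1::real}"
  let ?n = "card x"
  define f where "f p = (if s = 1 then p else 1 - p) ^ ?n" for p :: real
  define F where "F p = (if s = 1 then p ^ Suc ?n else - ((1 - p) ^ Suc ?n)) / real (Suc ?n)"
    for p :: real
  have deriv: "DERIV F p :> f p" for p
    unfolding F_def[abs_def] f_def
    by (cases "s = 1") (auto simp: field_simps simp del: power_Suc of_nat_Suc intro!: derivative_eq_intros)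
  have "emeasure (bayes_measure V) ?A = (\<integral>\<^sup>+p. emeasure (iid_signs V p) ?A \<partial>?U)"
    unfolding bayes_measure_def
    by (rule emeasure_bind[OF uniform_parameter_space_nonempty iid_signs_measurable[OF assms(1)]])
      auto
  also have "\<dots> = (\<integral>\<^sup>+p. ennreal (f p) \<partial>?U)"
    using assms
    by (intro nn_integral_cong)
      (subst emeasure_iid_signs_constant_on, auto simp: f_def space_restrict_space)
  also have "\<dots> = (\<integral>\<^sup>+p. ennreal (f p) * indicator {0..1} p \<partial>lborel)"
    by (rule nn_integral_restrict_space) simp
  also have "\<dots> = ennreal (F 1 - F 0)"
  proof -
    have "f \<in> borel_measurable borel" unfolding f_def by measurable
    moreover have "0 \<le> f p" if "0 \<le> p" "p \<le> 1" for p using that by (simp add: f_def)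
    ultimately show ?thesis
      using deriv by (intro nn_integral_FTC_Icc) auto
  qed
  also have "F 1 - F 0 = 1 / real (?n + 1)"
    by (auto simp: F_def)
  finally show ?thesis by (simp add: measure_def)
qed

text \<open>The complement consists of the two events that \<open>g\<close> is constantly \<open>1\<close> or constantly \<open>- 1\<close>
  on \<open>x\<close>; they are disjoint because \<open>x\<close> is non-empty, and each has probability
  \<open>1 / (card x + 1)\<close>.\<close>

lemma bayes_measure_both_signs:
  assumes "finite V" "x \<subseteq> V" "x \<noteq> {}"
  shows "measure (bayes_measure V) {g \<in> V \<rightarrow>\<^sub>E {- 1, 1}. g ` x = {- 1, 1}}
    = 1 - 2 / real (card x + 1)"
proof -
  interpret prob_space "bayes_measure V" by (rule prob_space_bayes_measure) fact
  let ?\<Omega> = "V \<rightarrow>\<^sub>E {- 1, 1::int}"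
  let ?C = "\<lambda>s. {g \<in> ?\<Omega>. \<forall>v\<in>x. g v = s}"
  have events: "A \<in> events" if "A \<subseteq> ?\<Omega>" for A
    using that assms(1) by (simp add: sets_bayes_measure)
  have both: "g ` x = {- 1, 1} \<longleftrightarrow> \<not> (\<forall>v\<in>x. g v = 1) \<and> \<not> (\<forall>v\<in>x. g v = - 1)"
    if "g \<in> ?\<Omega>" for g
  proof -
    have "\<forall>v\<in>x. g v = - 1 \<or> g v = 1" using that assms(2) by (auto simp: PiE_iff)
    then have "g ` x \<subseteq> {- 1, 1}" by auto
    then have "g ` x = {- 1, 1} \<longleftrightarrow> 1 \<in> g ` x \<and> - 1 \<in> g ` x" by auto
    also have "\<dots> \<longleftrightarrow> (\<exists>v\<in>x. g v \<noteq> - 1) \<and> (\<exists>v\<in>x. g v \<noteq> 1)"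
      using \<open>\<forall>v\<in>x. g v = - 1 \<or> g v = 1\<close> by (force simp: image_iff)
    finally show ?thesis by blast
  qed
  have "{g \<in> ?\<Omega>. g ` x = {- 1, 1}} = space (bayes_measure V) - (?C 1 \<union> ?C (- 1))"
    unfolding space_bayes_measure[OF assms(1)] using both by blast
  moreover have "?C 1 \<inter> ?C (- 1) = {}" using assms(3) by auto
  ultimately show ?thesis
    using events bayes_measure_constant_on[OF assms(1,2)]
    by (subst \<open>{g \<in> ?\<Omega>. g ` x = {- 1, 1}} = _\<close>, subst prob_compl)
      (auto simp: finite_measure_Union)
qed

lemma curvature_functional_sum_simplices:
  assumes "finite G"
  shows "curvature_functional G = 1 - (\<Sum>x\<in>G. (- 1) ^ sdim x / real (sdim x + 2))"
proof -
  let ?c = "\<lambda>k. (- 1) ^ k / real (k + 2)"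
  have "(\<Sum>x\<in>G. ?c (sdim x)) = (\<Sum>k=0..max_dim G. \<Sum>x\<in>{x \<in> G. sdim x = k}. ?c (sdim x))"
    using assms by (intro sum.group[symmetric]) (auto simp: max_dim_def)
  also have "\<dots> = (\<Sum>k=0..max_dim G. ?c k * real (f_number G k))"
    by (simp add: f_number_def mult.commute)
  finally show ?thesis
    by (simp add: curvature_functional_def sum_negf[symmetric])
qed

lemma expectation_level_surface_euler_char:
  assumes "finite V" "finite G"
  shows "prob_space.expectation (bayes_measure V) (\<lambda>g. real_of_int (level_surface_euler_char G g))
    = (\<Sum>x\<in>G. (- 1) ^ (sdim x - 1) *
        measure (bayes_measure V) {g \<in> V \<rightarrow>\<^sub>E {- 1, 1}. g ` x = {- 1, 1}})"
proof -
  interpret prob_space "bayes_measure V" by (rule prob_space_bayes_measure) fact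
  let ?A = "\<lambda>x. {g \<in> V \<rightarrow>\<^sub>E {- 1, 1::int}. g ` x = {- 1, 1}}"
  have events: "?A x \<in> events" for x
    using assms(1) by (auto simp: sets_bayes_measure)
  have "expectation (\<lambda>g. real_of_int (level_surface_euler_char G g))
    = expectation (\<lambda>g. \<Sum>x\<in>G. (- 1) ^ (sdim x - 1) * indicator (?A x) g)"
  proof (rule Bochner_Integration.integral_cong[OF refl])
    fix g assume "g \<in> space (bayes_measure V)"
    then have "g \<in> V \<rightarrow>\<^sub>E {- 1, 1}" using assms(1) by (simp add: space_bayes_measure)
    then have ind: "indicator (?A x) g = (if g ` x = {- 1, 1} then 1 else 0 :: real)" for x
      by (simp add: indicator_def)
    show "real_of_int (level_surface_euler_char G g)
      = (\<Sum>x\<in>G. (- 1) ^ (sdim x - 1) * indicator (?A x) g)"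
      unfolding ind using assms(2)
      by (simp add: level_surface_euler_char_def euler_char_with_def level_surface_def
          sum.inter_filter if_distrib cong: if_cong)
  qed
  also have "\<dots> = (\<Sum>x\<in>G. expectation (\<lambda>g. (- 1) ^ (sdim x - 1) * indicator (?A x) g))"
    using events
    by (intro Bochner_Integration.integral_sum integrable_mult_right integrable_real_indicator)
      (auto simp: emeasure_eq_measure)
  also have "\<dots> = (\<Sum>x\<in>G. (- 1) ^ (sdim x - 1) * prob (?A x))"
    using events sets.sets_into_space[OF events] by (simp add: Int_absorb2)
  finally show ?thesis .
qed

theorem theorem1:
  fixes G :: "'a set set"
  assumes "abstract_simplicial_complex G"
  shows "prob_space.expectation (bayes_measure (vertices G))
           (\<lambda>g. real_of_int (level_surface_euler_char G g))
         = 2 - 2 * curvature_functional G - real_of_int (euler_char G)"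
proof -
  have fin: "finite G" and simplex: "\<And>x. x \<in> G \<Longrightarrow> finite x \<and> x \<noteq> {}"
    using assms by (auto simp: abstract_simplicial_complex_def)
  have finV: "finite (vertices G)" using fin simplex by (auto simp: vertices_def)
  have contribution: "(- 1) ^ (sdim x - 1) *
      measure (bayes_measure (vertices G)) {g \<in> vertices G \<rightarrow>\<^sub>E {- 1, 1}. g ` x = {- 1, 1}}
    = 2 * ((- 1) ^ sdim x / real (sdim x + 2)) - (- 1) ^ sdim x" if "x \<in> G" for x
  proof -
    have "card x = sdim x + 1"
      using simplex[OF that] by (auto simp: sdim_def Suc_leI card_gt_0_iff)
    then have prob: "measure (bayes_measure (vertices G))
        {g \<in> vertices G \<rightarrow>\<^sub>E {- 1, 1}. g ` x = {- 1, 1}} = 1 - 2 / real (sdim x + 2)"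
      using bayes_measure_both_signs[OF finV, of x] simplex[OF that] that
      by (auto simp: vertices_def)
    \<comment> \<open>For a vertex the truncated exponent \<open>0 - 1\<close> has the wrong parity, but both sides are \<open>0\<close>.\<close>
    show ?thesis unfolding prob
      by (cases "sdim x") (auto simp: algebra_simps)
  qed
  have "prob_space.expectation (bayes_measure (vertices G))
      (\<lambda>g. real_of_int (level_surface_euler_char G g))
    = (\<Sum>x\<in>G. 2 * ((- 1) ^ sdim x / real (sdim x + 2)) - (- 1) ^ sdim x)"
    using expectation_level_surface_euler_char[OF finV fin] contribution by simp
  also have "\<dots> = 2 * (\<Sum>x\<in>G. (- 1) ^ sdim x / real (sdim x + 2)) - real_of_int (euler_char G)"
    by (simp add: sum_subtractf sum_distrib_left euler_char_def euler_char_with_def)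
  finally show ?thesis
    by (simp add: curvature_functional_sum_simplices[OF fin])
qed

end
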